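(* Let $K_{n_1,n_2,\dots,n_k}$ be the complete $k$-partite graph with parts of sizes $n_1,\dots,n_k$, where $\sum_{i=1}^k n_i=n$ and $n_i\geq 2$ for $i=1,2,\dots,k$. Then for any edge $e$ of $K_{n_1,n_2,\dots,n_k}$, $$E_{\varepsilon}(K_{n_1,n_2,\dots,n_k})<E_{\varepsilon}(K_{n_1,n_2,\dots,n_k}-e).$$
   Context: All graphs are finite, simple and connected. For a connected graph $G$, $d_G(u,v)$ is the length of a shortest $u$–$v$ path, and the eccentricity of a vertex $u$ is $e(u)=\max\{d_G(u,v): v\in V(G)\}$. The eccentricity matrix $\varepsilon(G)$ is the $|V(G)|\times|V(G)|$ matrix indexed by $V(G)$ with $\varepsilon(G)_{uv}=d_G(u,v)$ if $d_G(u,v)=\min\{e(u),e(v)\}$ and $\varepsilon(G)_{uv}=0$ otherwise. The eccentricity energy of $G$ is $E_{\varepsilon}(G)=\sum_i|\xi_i|$, where $\xi_i$ are the eigenvalues of $\varepsilon(G)$. $G-e$ denotes the graph obtained from $G$ by deleting the edge $e$ (keeping all vertices). *)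

theory Defs
  imports "Jordan_Normal_Form.Char_Poly"
begin

record 'a sgraph =
  verts :: "'a set"
  edges :: "'a set set"

definition adjacent :: "'a sgraph \<Rightarrow> 'a \<Rightarrow> 'a \<Rightarrow> bool" where
  "adjacent G u v \<longleftrightarrow> {u, v} \<in> edges G"

definition is_path :: "'a sgraph \<Rightarrow> 'a \<Rightarrow> 'a \<Rightarrow> 'a list \<Rightarrow> bool" where
  "is_path G u v p \<longleftrightarrow>
     p \<noteq> [] \<and> hd p = u \<and> last p = v \<and> set p \<subseteq> verts G \<and> distinct p \<and>
     successively (adjacent G) p"

(* The length of a path is its number of edges, one less than its number of vertices.
   For vertices of a connected graph a path always exists; otherwise the value is unspecified. *)
definition gdist :: "'a sgraph \<Rightarrow> 'a \<Rightarrow> 'a \<Rightarrow> nat" where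
  "gdist G u v = (LEAST l. \<exists>p. is_path G u v p \<and> length p = Suc l)"

definition eccentricity :: "'a sgraph \<Rightarrow> 'a \<Rightarrow> nat" where
  "eccentricity G u = Max {gdist G u v |v. v \<in> verts G}"

definition ecc_entry :: "'a sgraph \<Rightarrow> 'a \<Rightarrow> 'a \<Rightarrow> nat" where
  "ecc_entry G u v =
     (if gdist G u v = min (eccentricity G u) (eccentricity G v) then gdist G u v else 0)"

(* The rows and columns are indexed by positions in a list xs that enumerates the vertices.
   The entries are taken in the complex numbers, so that the characteristic polynomial splits. *)
definition ecc_matrix :: "'a sgraph \<Rightarrow> 'a list \<Rightarrow> complex mat" where
  "ecc_matrix G xs =
     mat (length xs) (length xs) (\<lambda>(i, j). of_nat (ecc_entry G (xs ! i) (xs ! j)))"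

definition vertex_list :: "'a sgraph \<Rightarrow> 'a list" where
  "vertex_list G = (SOME xs. distinct xs \<and> set xs = verts G)"

(* The eigenvalues are counted with algebraic multiplicity. *)
definition ecc_energy :: "'a sgraph \<Rightarrow> real" where
  "ecc_energy G =
     (\<Sum>\<xi> \<in># proots (char_poly (ecc_matrix G (vertex_list G))). cmod \<xi>)"

definition delete_edge :: "'a sgraph \<Rightarrow> 'a set \<Rightarrow> 'a sgraph" where
  "delete_edge G e = \<lparr>verts = verts G, edges = edges G - {e}\<rparr>"

(* The vertex (i, a) is the a-th vertex of the i-th part. *)
definition complete_multipartite :: "nat \<Rightarrow> (nat \<Rightarrow> nat) \<Rightarrow> (nat \<times> nat) sgraph" where
  "complete_multipartite k m =
     (let V = (SIGMA i:{1..k}. {1..m i})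
      in \<lparr>verts = V, edges = {{u, v} |u v. u \<in> V \<and> v \<in> V \<and> fst u \<noteq> fst v}\<rparr>)"

(* The energy does not depend on the enumeration chosen by vertex_list. *)
lemma char_poly_ecc_matrix_cong:
  assumes "distinct xs" "distinct ys" "set xs = set ys"
  shows "char_poly (ecc_matrix G xs) = char_poly (ecc_matrix G ys)"
proof -
  define n where "n = length xs"
  have ly: "length ys = n" using distinct_card[OF assms(1)] distinct_card[OF assms(2)] assms(3) n_def by simp
  have "mset xs = mset ys" using set_eq_iff_mset_eq_distinct[OF assms(1,2)] assms(3) by (rule iffD1)
  then obtain f where f: "f permutes {..<length ys}" "permute_list f ys = xs"
    by (rule mset_eq_permutation)
  have fp: "f permutes {0..<n}" using f(1) ly by (simp add: atLeast0LessThan)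
  have fn: "f i < n" if "i < n" for i using permutes_in_image[OF fp] that by simp
  have xs_nth: "xs ! i = ys ! f i" if "i < n" for i
    using permute_list_nth[OF f(1), of i] f(2) that ly by simp
  define A where "A = char_poly_matrix (ecc_matrix G xs)"
  define B where "B = char_poly_matrix (ecc_matrix G ys)"
  define C where "C = mat n n (\<lambda>(i, j). B $$ (f i, j))"
  have A: "A \<in> carrier_mat n n" and B: "B \<in> carrier_mat n n" and C: "C \<in> carrier_mat n n"
    by (simp_all add: A_def B_def C_def char_poly_matrix_def ecc_matrix_def ly flip: n_def)
  have f_eq: "f i = f j \<longleftrightarrow> i = j" for i j
    using permutes_inj[OF fp] by (rule inj_eq)
  have A_nth: "A $$ (i, j) = B $$ (f i, f j)" if "i < n" "j < n" for i j
    using that fn[OF that(1)] fn[OF that(2)]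
    by (simp add: A_def B_def char_poly_matrix_def ecc_matrix_def ly f_eq xs_nth flip: n_def)
  have "transpose_mat A = mat n n (\<lambda>(i, j). transpose_mat C $$ (f i, j))"
    using A C by (intro eq_matI) (simp_all add: A_nth C_def fn)
  then have "det (transpose_mat A) = signof f * det (transpose_mat C)"
    using det_permute_rows[OF _ fp, of "transpose_mat C"] C by simp
  then have "det A = signof f * det C"
    by (simp only: det_transpose[OF A] det_transpose[OF C])
  also have "det C = signof f * det B"
    unfolding C_def by (rule det_permute_rows[OF B fp])
  finally have "det A = signof f * (signof f * det B)" .
  then have "det A = det B" by (cases "evenperm f") (simp_all add: sign_def)
  then show ?thesis by (simp only: char_poly_def A_def B_def)
qed

lemma ecc_energy_eq:
  assumes "distinct xs" "set xs = verts G"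
  shows "ecc_energy G = (\<Sum>\<xi> \<in># proots (char_poly (ecc_matrix G xs)). cmod \<xi>)"
proof -
  have "distinct (vertex_list G) \<and> set (vertex_list G) = verts G"
    unfolding vertex_list_def by (rule someI[of _ xs]) (simp add: assms)
  then show ?thesis
    using char_poly_ecc_matrix_cong[of "vertex_list G" xs G] assms
    by (simp add: ecc_energy_def)
qed

end

theory Submission
  imports Defs "Jordan_Normal_Form.Schur_Decomposition"
begin

text \<open>
  For the complete multipartite graph K the eccentricity matrix is block diagonal with blocks
  2(J - I), so its energy is 4(n - k). Deleting the edge uv only adds an entry t at the positions
  (u,v) and (v,u), where t is the new distance of u and v (2 if there is a third part, 3 otherwise).
  Let M be the new matrix. As M + 2I has rank at most k + 2, the eigenvalue -2 of M has multiplicity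
  at least n - k - 2. Two further eigenvalues are y - 2 and z - 2, where y < 0 < z are roots of the
  quartic (Y - 2a)(Y - 2b)Y^2 - t^2(Y - 2a + 2)(Y - 2b + 2), with a and b the sizes of the
  parts of u and v, and y + z < 0. Hence some of the eigenvalues of M sum to less than -2(n - k);
  since the trace is 0, the others sum to more than 2(n - k), and the energy exceeds 4(n - k).
\<close>

section \<open>Distances from explicit paths and lower bounds on path lengths\<close>

lemma is_path_length_ge_2:
  assumes "is_path G u v p" "u \<noteq> v"
  shows "2 \<le> length p"
  using assms by (cases p rule: list.exhaust[case_product list.exhaust, of _ "tl p"])
    (auto simp: is_path_def Suc_le_eq)

lemma is_path_length_ge_3:
  assumes "is_path G u v p" "u \<noteq> v" "\<not> adjacent G u v"
  shows "3 \<le> length p"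
proof (rule ccontr)
  assume "\<not> 3 \<le> length p"
  with is_path_length_ge_2[OF assms(1,2)] have "length p = 2" by simp
  then obtain x y where "p = [x, y]" by (auto simp: numeral_2_eq_2 length_Suc_conv)
  with assms show False by (auto simp: is_path_def)
qed

lemma is_path_length_ge_4:
  assumes "is_path G u v p" "u \<noteq> v" "\<not> adjacent G u v"
    and "\<And>w. w \<in> verts G \<Longrightarrow> \<not> (adjacent G u w \<and> adjacent G w v)"
  shows "4 \<le> length p"
proof (rule ccontr)
  assume "\<not> 4 \<le> length p"
  with is_path_length_ge_3[OF assms(1-3)] have "length p = 3" by simp
  then obtain x y z where "p = [x, y, z]" by (auto simp: numeral_3_eq_3 length_Suc_conv)
  with assms(1) assms(4)[of y] show False by (auto simp: is_path_def)
qed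

lemma gdist_eqI:
  assumes "is_path G u v p" "length p = Suc l"
    and "\<And>q. is_path G u v q \<Longrightarrow> Suc l \<le> length q"
  shows "gdist G u v = l"
  unfolding gdist_def
proof (rule Least_equality)
  show "\<exists>p. is_path G u v p \<and> length p = Suc l" using assms(1,2) by blast
  show "l \<le> y" if "\<exists>p. is_path G u v p \<and> length p = Suc y" for y
    using that assms(3) by force
qed

lemma gdist_self: "u \<in> verts G \<Longrightarrow> gdist G u u = 0"
  by (rule gdist_eqI[of _ _ _ "[u]"]) (auto simp: is_path_def Suc_le_eq)

lemma gdist_adjacent:
  assumes "u \<in> verts G" "v \<in> verts G" "u \<noteq> v" "adjacent G u v"
  shows "gdist G u v = 1"
proof -
  have "is_path G u v [u, v]" using assms by (auto simp: is_path_def)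
  then show ?thesis using assms is_path_length_ge_2[of G u v]
    by (intro gdist_eqI) (auto simp: numeral_2_eq_2)
qed

lemma gdist_eq_2:
  assumes "u \<in> verts G" "v \<in> verts G" "w \<in> verts G" "u \<noteq> v" "w \<noteq> u" "w \<noteq> v"
    and "\<not> adjacent G u v" "adjacent G u w" "adjacent G w v"
  shows "gdist G u v = 2"
proof -
  have "is_path G u v [u, w, v]" using assms by (auto simp: is_path_def)
  then show ?thesis using assms is_path_length_ge_3[of G u v] by (intro gdist_eqI) auto
qed

lemma gdist_eq_3:
  assumes "{u, v, w, x} \<subseteq> verts G" "distinct [u, w, x, v]"
    and "\<not> adjacent G u v" "adjacent G u w" "adjacent G w x" "adjacent G x v"
    and "\<And>w. w \<in> verts G \<Longrightarrow> \<not> (adjacent G u w \<and> adjacent G w v)"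
  shows "gdist G u v = 3"
proof -
  have "is_path G u v [u, w, x, v]" using assms by (auto simp: is_path_def)
  then show ?thesis using assms is_path_length_ge_4[of G u v] by (intro gdist_eqI) auto
qed

lemma eccentricity_eqI:
  assumes "finite (verts G)" "v \<in> verts G" "gdist G u v = d"
    and "\<And>w. w \<in> verts G \<Longrightarrow> gdist G u w \<le> d"
  shows "eccentricity G u = d"
  unfolding eccentricity_def
  by (rule Max_eqI) (use assms in auto)

section \<open>Spectra of matrices of low rank plus a scalar matrix, traces, and an energy
  bound\<close>

text \<open>Sylvester's determinant identity. The powers of \<open>c\<close> keep it free of
  division, so that it applies over a polynomial ring with \<open>c\<close> a linear
  polynomial.\<close>

lemma det_one_minus_mult_comm:
  fixes c :: "'a :: idom"
  assumes A: "A \<in> carrier_mat n m" and B: "B \<in> carrier_mat m n"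
  shows "c ^ m * det (c \<cdot>\<^sub>m 1\<^sub>m n - A * B) = c ^ n * det (c \<cdot>\<^sub>m 1\<^sub>m m - B * A)"
proof -
  \<comment> \<open>Multiplying ?F by ?R on the right, resp. by ?L on the left, eliminates the lower left block.\<close>
  let ?F = "four_block_mat (c \<cdot>\<^sub>m 1\<^sub>m n) A B (1\<^sub>m m)"
  let ?R = "four_block_mat (1\<^sub>m n) (0\<^sub>m n m) (- B) (1\<^sub>m m)"
  let ?L = "four_block_mat (1\<^sub>m n) (0\<^sub>m n m) (- B) (c \<cdot>\<^sub>m 1\<^sub>m m)"
  have F: "?F \<in> carrier_mat (n + m) (n + m)" and R: "?R \<in> carrier_mat (n + m) (n + m)"
    and L: "?L \<in> carrier_mat (n + m) (n + m)"
    using A B by auto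
  have AB: "c \<cdot>\<^sub>m 1\<^sub>m n - A * B \<in> carrier_mat n n" and BA: "c \<cdot>\<^sub>m 1\<^sub>m m - B * A \<in> carrier_mat m m"
    using A B by auto
  have "?F * ?R = four_block_mat (c \<cdot>\<^sub>m 1\<^sub>m n - A * B) A (0\<^sub>m m n) (1\<^sub>m m)"
    using A B by (subst mult_four_block_mat[of _ n n _ m _ m _ _ n _ m]) (auto simp: uminus_l_inv_mat)
  then have 1: "det ?F = det (c \<cdot>\<^sub>m 1\<^sub>m n - A * B)"
    using det_mult[OF F R] A B AB
    by (simp add: det_four_block_mat_upper_right_zero[of _ n _ m] det_four_block_mat_lower_left_zero[of _ n _ m])
  have "?L * ?F = four_block_mat (c \<cdot>\<^sub>m 1\<^sub>m n) A (0\<^sub>m m n) (c \<cdot>\<^sub>m 1\<^sub>m m - B * A)"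
    using A B by (subst mult_four_block_mat[of _ n n _ m _ m _ _ n _ m]) auto
  then have "c ^ m * det ?F = c ^ n * det (c \<cdot>\<^sub>m 1\<^sub>m m - B * A)"
    using det_mult[OF L F] A B BA
    by (simp add: det_four_block_mat_upper_right_zero[of _ n _ m] det_four_block_mat_lower_left_zero[of _ n _ m])
  with 1 show ?thesis by simp
qed

text \<open>With \<open>X\<close> the indeterminate, \<open>X I - C\<close> equals
  \<open>(X + c) I - A B\<close>, so the determinant identity over the polynomial ring trades an
  \<open>n\<close> by \<open>n\<close> determinant for an \<open>m\<close> by \<open>m\<close>
  one.\<close>

lemma char_poly_low_rank:
  fixes A :: "'a :: idom mat"
  assumes A: "A \<in> carrier_mat n m" and B: "B \<in> carrier_mat m n" and C: "C \<in> carrier_mat n n"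
    and eq: "C + c \<cdot>\<^sub>m 1\<^sub>m n = A * B"
  shows "[:c, 1:] ^ m * char_poly C
    = [:c, 1:] ^ n * det ([:c, 1:] \<cdot>\<^sub>m 1\<^sub>m m - map_mat (\<lambda>a. [:a:]) (B * A))"
proof -
  let ?p = "map_mat (\<lambda>a :: 'a. [:a:])"
  have "C $$ (i, j) + (if i = j then c else 0) = (A * B) $$ (i, j)" if "i < n" "j < n" for i j
    using that C by (simp flip: eq)
  then have "char_poly_matrix C = [:c, 1:] \<cdot>\<^sub>m 1\<^sub>m n - ?p (A * B)"
    using C A B
    by (intro eq_matI) (auto simp: char_poly_matrix_def simp flip: eq)
  then show ?thesis
    using det_one_minus_mult_comm[of "?p A" n m "?p B" "[:c, 1:]"] A B
    by (simp add: char_poly_def map_poly_mult(1)[OF A B] map_poly_mult(1)[OF B A])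
qed

text \<open>The Schur form \<open>T\<close> carries the roots of the characteristic polynomial on
  its diagonal, and similarity preserves the trace.\<close>

lemma sum_proots_char_poly:
  fixes C :: "complex mat"
  assumes C: "C \<in> carrier_mat n n"
  shows "(\<Sum>\<xi>\<in>#proots (char_poly C). \<xi>) = (\<Sum>i<n. C $$ (i, i))"
proof -
  obtain es where es: "char_poly C = (\<Prod>a\<leftarrow>es. [:- a, 1:])"
    using char_poly_factorized[OF C] by blast
  obtain T P Q where TPQ: "schur_decomposition C es = (T, P, Q)" by (cases "schur_decomposition C es")
  from schur_decomposition[OF C es TPQ] have sim: "similar_mat_wit C T P Q" and dT: "diag_mat T = es"
    by auto
  from sim C have T: "T \<in> carrier_mat n n" and P: "P \<in> carrier_mat n n" and Q: "Q \<in> carrier_mat n n"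
    and QP: "Q * P = 1\<^sub>m n" and CT: "C = P * T * Q"
    by (auto simp: similar_mat_wit_def Let_def)
  \<comment> \<open>Cyclicity of the trace moves \<open>Q\<close> from the right end of
    \<open>P * T * Q\<close> to the left, where it cancels against \<open>P\<close>.\<close>
  have tr: "(\<Sum>i<n. (X * Y) $$ (i, i)) = (\<Sum>i<n. (Y * X) $$ (i, i))"
    if "X \<in> carrier_mat n n" "Y \<in> carrier_mat n n" for X Y :: "complex mat"
  proof -
    have "(\<Sum>i<n. (X * Y) $$ (i, i)) = (\<Sum>i<n. \<Sum>j<n. X $$ (i, j) * Y $$ (j, i))"
      using that by (simp add: scalar_prod_def atLeast0LessThan)
    also have "\<dots> = (\<Sum>j<n. \<Sum>i<n. Y $$ (j, i) * X $$ (i, j))"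
      by (subst sum.swap) (simp add: mult.commute)
    also have "\<dots> = (\<Sum>i<n. (Y * X) $$ (i, i))"
      using that by (simp add: scalar_prod_def atLeast0LessThan)
    finally show ?thesis .
  qed
  have "(\<Sum>i<n. C $$ (i, i)) = (\<Sum>i<n. (Q * (P * T)) $$ (i, i))"
    unfolding CT using P T Q by (intro tr) auto
  also have "Q * (P * T) = T"
    using P T Q by (simp add: QP flip: assoc_mult_mat[of Q n n P n T n])
  also have "(\<Sum>i<n. T $$ (i, i)) = sum_list es"
    using T unfolding dT[symmetric] by (simp add: diag_mat_def interv_sum_list_conv_sum_set_nat atLeast0LessThan)
  also have "sum_list es = (\<Sum>\<xi>\<in>#proots (char_poly C). \<xi>)"
    unfolding es
  proof (induction es)
    case (Cons a es)
    have "(\<Prod>a\<leftarrow>es. [:- a, 1:]) \<noteq> 0" by (auto simp: prod_list_zero_iff)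
    then show ?case using Cons by (simp add: proots_mult del: mult_pCons_left)
  qed simp
  finally show ?thesis by simp
qed

text \<open>The complement of \<open>S\<close> in \<open>R\<close> sums to minus the sum of
  \<open>S\<close>, so the triangle inequality gives the same lower bound for both pieces. This
  bounds an energy from below when only part of the spectrum is known.\<close>

lemma sum_cmod_ge_twice_subset:
  assumes "S \<subseteq># R" "(\<Sum>\<xi>\<in>#R. \<xi>) = (0 :: complex)"
  shows "2 * cmod (\<Sum>\<xi>\<in>#S. \<xi>) \<le> (\<Sum>\<xi>\<in>#R. cmod \<xi>)"
proof -
  have norm: "cmod (\<Sum>\<xi>\<in>#X. \<xi>) \<le> (\<Sum>\<xi>\<in>#X. cmod \<xi>)" for X
    by (induction X) (auto intro: order.trans[OF norm_triangle_ineq])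
  from assms(1) obtain T where R: "R = S + T" by (auto simp: mset_subset_eq_exists_conv)
  with assms(2) have "(\<Sum>\<xi>\<in>#T. \<xi>) = - (\<Sum>\<xi>\<in>#S. \<xi>)" by (simp add: eq_neg_iff_add_eq_0 add.commute)
  with norm[of S] norm[of T] R show ?thesis by simp
qed

section \<open>Two real roots of the quartic with negative sum\<close>

lemma quartic_roots:
  fixes a b :: nat and t :: real
  assumes "2 \<le> a" "2 \<le> b" "0 < t" "t \<le> 3"
  defines "Q \<equiv> \<lambda>y :: real. y\<^sup>2 * (y - 2 * a) * (y - 2 * b) - t\<^sup>2 * (y - 2 * a + 2) * (y - 2 * b + 2)"
  shows "\<exists>y z. Q y = 0 \<and> Q z = 0 \<and> y < 0 \<and> 0 < z \<and> y + z < 0"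
proof -
  define A B S where "A = real a" and "B = real b" and "S = A + B"
  have A: "2 \<le> A" and B: "2 \<le> B" using assms by (auto simp: A_def B_def)
  have Q: "Q y = y\<^sup>2 * (y - 2 * A) * (y - 2 * B) - t\<^sup>2 * (y - 2 * A + 2) * (y - 2 * B + 2)" for y
    by (simp add: Q_def A_def B_def)
  \<comment> \<open>\<open>w\<close> is chosen so that \<open>t\<^sup>2 * w\<close> is the square of
    the positive zero of \<open>t\<^sup>2 * (S - 2) - S * y\<^sup>2\<close>, the factor of
    \<open>Q y - Q (- y)\<close> found in \<open>odd\<close> below.\<close>
  define w where "w = 1 - 2 / S"
  have S: "4 \<le> S" using A B by (simp add: S_def)
  have w: "0 < w" "w < 1" using S by (auto simp: w_def field_simps)
  have wS: "w * S = S - 2" using S by (simp add: w_def field_simps)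
  have t2: "0 < t\<^sup>2" "t\<^sup>2 \<le> 9" using assms power_mono[of t 3 2] by auto
  \<comment> \<open>This inequality decides the sign of \<open>Q s + Q (- s)\<close>. If some part
    has size at least 3, the right side is at least 16, and \<open>w < 1\<close> with
    \<open>t\<^sup>2 \<le> 9\<close> suffices. For \<open>a = b = 2\<close> it is only 8, so the
    exact value \<open>w = 1/2\<close> is used.\<close>
  have key: "t\<^sup>2 * w < 2 * (A\<^sup>2 + B\<^sup>2 - S)"
  proof (cases "a = 2 \<and> b = 2")
    case True
    then have "A = 2" "B = 2" by (auto simp: A_def B_def)
    then show ?thesis using t2 by (simp add: w_def S_def)
  next
    case False
    then have "3 \<le> a \<or> 3 \<le> b" using assms by linarith
    then have "3 \<le> A \<or> 3 \<le> B" by (auto simp: A_def B_def)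
    moreover have "2 \<le> A * (A - 1)" "2 \<le> B * (B - 1)"
      using mult_mono[of 2 A 1 "A - 1"] mult_mono[of 2 B 1 "B - 1"] A B by auto
    moreover have "3 \<le> A \<Longrightarrow> 6 \<le> A * (A - 1)" "3 \<le> B \<Longrightarrow> 6 \<le> B * (B - 1)"
      using mult_mono[of 3 A 2 "A - 1"] mult_mono[of 3 B 2 "B - 1"] by auto
    ultimately have "8 \<le> A * (A - 1) + B * (B - 1)" by linarith
    moreover have "t\<^sup>2 * w < 9"
      using mult_strict_left_mono[OF w(2) t2(1)] t2(2) by linarith
    ultimately show ?thesis by (simp add: power2_eq_square algebra_simps S_def)
  qed
  \<comment> \<open>\<open>s\<close> is the positive zero of the odd part of Q. Between 0 and s the odd part is positive,
    so if \<open>y\<close> in (-s, 0) is a root of Q, then Q(-y) > 0 > Q(0) and there is another root between 0 and -y.\<close>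
  define s where "s = t * sqrt w"
  have s2: "s\<^sup>2 = t\<^sup>2 * w" using w by (simp add: s_def power_mult_distrib)
  have s: "0 < s" using assms w by (simp add: s_def)
  have cont: "continuous_on X Q" for X unfolding Q_def by (intro continuous_intros)
  have odd: "Q y - Q (- y) = 4 * y * (t\<^sup>2 * (S - 2) - S * y\<^sup>2)" for y
    unfolding Q S_def by (simp add: power2_eq_square algebra_simps)
  \<comment> \<open>The odd part of \<open>Q\<close> vanishes at \<open>s\<close>, so
    \<open>Q (- s)\<close> is half of \<open>Q s + Q (- s)\<close>. Multiplying by \<open>S\<close>
    turns \<open>w * S\<close> into \<open>S - 2\<close> and leaves exactly the difference in
    \<open>key\<close>.\<close>
  have "S * (Q s + Q (- s)) = 4 * t\<^sup>2 * (2 * (A\<^sup>2 + B\<^sup>2 - S) - t\<^sup>2 * w)"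
  proof -
    have "Q s + Q (- s) = 2 * ((s\<^sup>2)\<^sup>2 + 4 * A * B * s\<^sup>2 - t\<^sup>2 * s\<^sup>2 - t\<^sup>2 * (2 * A - 2) * (2 * B - 2))"
      unfolding Q by (simp add: power2_eq_square algebra_simps)
    also have "\<dots> = 2 * t\<^sup>2 * (t\<^sup>2 * w * w + 4 * A * B * w - t\<^sup>2 * w - 4 * A * B + 4 * S - 4)"
      unfolding s2 S_def by (simp add: power2_eq_square algebra_simps)
    finally have eq: "Q s + Q (- s) =
        2 * t\<^sup>2 * (t\<^sup>2 * w * w + 4 * A * B * w - t\<^sup>2 * w - 4 * A * B + 4 * S - 4)" .
    have "S * (Q s + Q (- s)) =
        2 * t\<^sup>2 * (t\<^sup>2 * w * (w * S) + 4 * A * B * (w * S) - t\<^sup>2 * w * S - 4 * A * B * S + 4 * S * S - 4 * S)"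
      unfolding eq by (simp add: algebra_simps)
    also have "\<dots> = 2 * t\<^sup>2 * (- 2 * t\<^sup>2 * w - 8 * A * B + 4 * S * S - 4 * S)"
      unfolding wS by (simp add: algebra_simps)
    also have "\<dots> = 4 * t\<^sup>2 * (2 * (A\<^sup>2 + B\<^sup>2 - S) - t\<^sup>2 * w)"
      unfolding S_def by (simp add: power2_eq_square algebra_simps)
    finally show ?thesis .
  qed
  also have "\<dots> > 0" using key t2 by simp
  finally have "0 < Q s + Q (- s)" using S by (simp add: zero_less_mult_iff)
  moreover have "S * s\<^sup>2 = t\<^sup>2 * (S - 2)" by (simp add: s2 flip: wS)
  then have "Q s = Q (- s)" using odd[of s] by simp
  ultimately have Qs: "0 < Q (- s)" by simp
  have "0 < t\<^sup>2 * (2 * A - 2) * (2 * B - 2)" using t2 A B by simp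
  then have Q0: "Q 0 < 0" unfolding Q by (simp add: algebra_simps)
  obtain y where y: "- s \<le> y" "y \<le> 0" "Q y = 0"
    using IVT2'[of Q 0 0 "- s"] Qs Q0 s cont by auto
  with Qs Q0 have ys: "- s < y" "y < 0" by (metis less_le less_irrefl)+
  then have "y\<^sup>2 < s\<^sup>2" using power_strict_mono[of "- y" s 2] by simp
  then have "S * y\<^sup>2 < t\<^sup>2 * (S - 2)"
    using mult_strict_left_mono[of "y\<^sup>2" "s\<^sup>2" S] S by (simp add: s2 wS[symmetric] algebra_simps)
  then have "0 < Q (- y)" using odd[of "- y"] y(3) ys by (simp add: mult_less_0_iff)
  then obtain z where z: "0 \<le> z" "z \<le> - y" "Q z = 0"
    using IVT'[of Q 0 0 "- y"] Q0 ys cont by auto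
  have "z \<noteq> 0" using z(3) Q0 by auto
  moreover have "z \<noteq> - y" using z(3) \<open>0 < Q (- y)\<close> by auto
  ultimately show ?thesis using y z ys by (intro exI[of _ y] exI[of _ z]) auto
qed

section \<open>Eccentricity matrices of the complete multipartite graph and of its edge
  deletion\<close>

lemma verts_complete_multipartite:
  "verts (complete_multipartite k m) = (SIGMA i:{1..k}. {1..m i})"
  by (simp add: complete_multipartite_def Let_def)

lemma adjacent_complete_multipartite:
  "adjacent (complete_multipartite k m) x y \<longleftrightarrow>
     x \<in> verts (complete_multipartite k m) \<and> y \<in> verts (complete_multipartite k m) \<and> fst x \<noteq> fst y"
proof
  assume "adjacent (complete_multipartite k m) x y"
  then obtain u v where "{x, y} = {u, v}" "u \<in> (SIGMA i:{1..k}. {1..m i})"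
    "v \<in> (SIGMA i:{1..k}. {1..m i})" "fst u \<noteq> fst v"
    by (auto simp: adjacent_def complete_multipartite_def Let_def)
  then show "x \<in> verts (complete_multipartite k m) \<and> y \<in> verts (complete_multipartite k m) \<and> fst x \<noteq> fst y"
    unfolding verts_complete_multipartite by (metis doubleton_eq_iff)
next
  assume "x \<in> verts (complete_multipartite k m) \<and> y \<in> verts (complete_multipartite k m) \<and> fst x \<noteq> fst y"
  then show "adjacent (complete_multipartite k m) x y"
    unfolding verts_complete_multipartite adjacent_def complete_multipartite_def Let_def
    by (simp only: sgraph.select_convs) blast
qed

lemma verts_delete_edge [simp]: "verts (delete_edge G e) = verts G"
  by (simp add: delete_edge_def)

lemma adjacent_delete_edge: "adjacent (delete_edge G e) x y \<longleftrightarrow> adjacent G x y \<and> {x, y} \<noteq> e"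
  by (auto simp: delete_edge_def adjacent_def)

lemma finite_verts_complete_multipartite: "finite (verts (complete_multipartite k m))"
  by (simp add: verts_complete_multipartite)

text \<open>The source of intermediate vertices on shortest paths and of vertices realising an
  eccentricity: the first two vertices of a part cannot both be \<open>z\<close>.\<close>

lemma ex_vertex_in_part:
  assumes "i \<in> {1..k}" "2 \<le> m i"
  shows "\<exists>w. w \<in> verts (complete_multipartite k m) \<and> fst w = i \<and> w \<noteq> z"
proof -
  have "(i, 1) \<in> verts (complete_multipartite k m)" "(i, 2) \<in> verts (complete_multipartite k m)"
    using assms by (auto simp: verts_complete_multipartite)
  moreover have "(i, 1) \<noteq> z \<or> (i, 2) \<noteq> z" by auto
  ultimately show ?thesis by (metis fst_conv)
qed

lemma fst_vertex: "x \<in> verts (complete_multipartite k m) \<Longrightarrow> fst x \<in> {1..k}"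
  by (auto simp: verts_complete_multipartite)

text \<open>All eccentricities are 2, realised by another vertex of the same part. Pairs at distance
  1 therefore contribute 0, and only pairs inside a part survive.\<close>

lemma ecc_entry_complete_multipartite:
  assumes m: "\<And>i. i \<in> {1..k} \<Longrightarrow> m i \<ge> 2" and k: "2 \<le> k"
  defines "G \<equiv> complete_multipartite k m"
  assumes x: "x \<in> verts G" and y: "y \<in> verts G"
  shows "ecc_entry G x y = (if fst x = fst y \<and> x \<noteq> y then 2 else 0)"
proof -
  note adj = adjacent_complete_multipartite[of k m, folded G_def]
  have dist: "gdist G x y = (if x = y then 0 else if fst x = fst y then 2 else 1)"
    if x: "x \<in> verts G" and y: "y \<in> verts G" for x y
  proof (cases "x \<noteq> y \<and> fst x = fst y")
    case True
    define j where "j = (if fst x = 1 then 2 else 1 :: nat)"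
    have j: "j \<in> {1..k}" "j \<noteq> fst x" using k by (auto simp: j_def)
    obtain w where "w \<in> verts G" "fst w = j"
      using ex_vertex_in_part[of j k m, OF j(1) m[OF j(1)]] unfolding G_def by blast
    then have "gdist G x y = 2"
      using True x y j by (intro gdist_eq_2[of _ _ _ w]) (auto simp: adj)
    with True show ?thesis by simp
  next
    case False
    then show ?thesis using x y gdist_self[of x G] gdist_adjacent[of x G y] by (auto simp: adj)
  qed
  have ecc: "eccentricity G x = 2" if x: "x \<in> verts G" for x
  proof -
    have i: "fst x \<in> {1..k}" using fst_vertex x by (simp add: G_def)
    obtain w where "w \<in> verts G" "fst w = fst x" "w \<noteq> x"
      using ex_vertex_in_part[of _ k m, OF i m[OF i], of x] unfolding G_def by blast
    then show ?thesis
      using x finite_verts_complete_multipartite[of k m, folded G_def]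
      by (intro eccentricity_eqI[of _ w]) (auto simp: dist)
  qed
  show ?thesis unfolding ecc_entry_def using x y by (auto simp: dist ecc)
qed

text \<open>The deletion changes only the distance between \<open>u\<close> and \<open>v\<close>,
  from 1 to \<open>t\<close>, and makes \<open>t\<close> the eccentricity of these two vertices; all
  other eccentricities stay 2. So the entry at \<open>u\<close>, \<open>v\<close> becomes
  \<open>t\<close> and every other entry is as before.\<close>

lemma ecc_entry_delete_edge:
  assumes m: "\<And>i. i \<in> {1..k} \<Longrightarrow> m i \<ge> 2"
  defines "G \<equiv> complete_multipartite k m"
  assumes u: "u \<in> verts G" and v: "v \<in> verts G" and uv: "fst u \<noteq> fst v"
  shows "\<exists>t \<in> {2, 3}. \<forall>x \<in> verts G. \<forall>y \<in> verts G.
    ecc_entry (delete_edge G {u, v}) x y =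
      (if fst x = fst y \<and> x \<noteq> y then 2 else if {x, y} = {u, v} then t else 0)"
proof -
  define H where "H = delete_edge G {u, v}"
  \<comment> \<open>A vertex of a third part joins \<open>u\<close> and \<open>v\<close> by a path
    of length 2; with only two parts they have no common neighbour and the distance is 3.\<close>
  define t where "t = (if {1..k} \<subseteq> {fst u, fst v} then 3 else 2 :: nat)"
  have V: "verts H = verts G" by (simp add: H_def)
  have adj: "adjacent H x y \<longleftrightarrow> x \<in> verts G \<and> y \<in> verts G \<and> fst x \<noteq> fst y \<and> {x, y} \<noteq> {u, v}" for x y
    unfolding H_def adjacent_delete_edge G_def adjacent_complete_multipartite by simp
  have fstV: "fst x \<in> {1..k}" if "x \<in> verts G" for x using fst_vertex that by (simp add: G_def)
  have vertex: "\<exists>w. w \<in> verts G \<and> fst w = i \<and> w \<noteq> z" if "i \<in> {1..k}" for i z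
    using ex_vertex_in_part[of i k m, OF that m[OF that]] unfolding G_def .
  \<comment> \<open>A vertex outside \<open>{u, v}\<close> keeps all its edges, so it can safely
    serve as the middle of a path of length 2.\<close>
  have avoid: "\<exists>w. w \<in> verts G \<and> fst w = i \<and> w \<notin> {u, v}" if "i \<in> {fst u, fst v}" for i
  proof -
    define z where "z = (if i = fst u then u else v)"
    have z: "i = fst z" "i \<in> {1..k}" using that fstV[OF u] fstV[OF v] by (auto simp: z_def)
    obtain w where w: "w \<in> verts G" "fst w = i" "w \<noteq> z" using vertex[OF z(2), of z] by blast
    moreover have "w \<noteq> u" "w \<noteq> v" using w(2,3) uv by (auto simp: z_def split: if_splits)
    ultimately show ?thesis by blast
  qed
  have nonadj: "gdist H x y = 2" if "x \<in> verts G" "y \<in> verts G" "x \<noteq> y" "fst x = fst y" for x y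
  proof -
    define i where "i = (if fst x = fst u then fst v else fst u)"
    have i: "i \<in> {fst u, fst v}" "i \<noteq> fst x" using uv by (auto simp: i_def)
    from avoid[OF i(1)] obtain w where "w \<in> verts G" "fst w = i" "w \<notin> {u, v}"
      by (elim exE conjE)
    with i(2) have "w \<in> verts G" "fst w \<noteq> fst x" "w \<notin> {u, v}" by simp_all
    then show ?thesis using that
      by (intro gdist_eq_2[of _ _ _ w]) (auto simp: adj V doubleton_eq_iff)
  qed
  have edge: "gdist H x y = t" if e: "{x, y} = {u, v}" for x y
  proof -
    have xy: "x \<in> verts G" "y \<in> verts G" "fst x \<noteq> fst y"
      using e u v uv by (auto simp: doubleton_eq_iff)
    have fst_e: "{fst x, fst y} = {fst u, fst v}" using e by (auto simp: doubleton_eq_iff)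
    show ?thesis
    proof (cases "{1..k} \<subseteq> {fst u, fst v}")
      case True
      obtain a where a: "a \<in> verts G" "fst a = fst x" "a \<noteq> x"
        using vertex[OF fstV[OF xy(1)], of x] by (elim exE conjE)
      obtain b where b: "b \<in> verts G" "fst b = fst y" "b \<noteq> y"
        using vertex[OF fstV[OF xy(2)], of y] by (elim exE conjE)
      \<comment> \<open>The path is \<open>x, b, a, y\<close>, which alternates between the two
        parts. None of its edges is the deleted one.\<close>
      have "gdist H x y = 3"
      proof (rule gdist_eq_3[of _ _ b a])
        show "\<not> (adjacent H x w \<and> adjacent H w y)" if "w \<in> verts H" for w
        proof -
          have "fst w \<in> {fst x, fst y}"
            unfolding fst_e by (rule subsetD[OF True fstV]) (use that V in simp)
          then have "fst w = fst x \<or> fst w = fst y" by simp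
          then show ?thesis by (elim disjE) (simp_all add: adj)
        qed
      qed (use a b xy in \<open>auto simp: adj V e[symmetric] doubleton_eq_iff\<close>)
      then show ?thesis using True by (simp add: t_def)
    next
      case False
      then obtain i where i: "i \<in> {1..k}" "i \<notin> {fst x, fst y}" unfolding fst_e by blast
      then obtain w where "w \<in> verts G" "fst w = i"
        using vertex[OF i(1)] by blast
      then have "gdist H x y = 2" using i xy
        by (intro gdist_eq_2[of _ _ _ w]) (auto simp: adj V e[symmetric] doubleton_eq_iff)
      then show ?thesis using False by (simp add: t_def)
    qed
  qed
  have dist: "gdist H x y =
      (if x = y then 0 else if fst x = fst y then 2 else if {x, y} = {u, v} then t else 1)"
    if "x \<in> verts G" "y \<in> verts G" for x y
    using that gdist_self[of x H] gdist_adjacent[of x H y] nonadj[of x y] edge[of x y]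
    by (auto simp: adj V)
  have t: "t = 2 \<or> t = 3" by (simp add: t_def)
  have fin: "finite (verts H)" by (simp add: V G_def finite_verts_complete_multipartite)
  have ecc: "eccentricity H x = (if x \<in> {u, v} then t else 2)" if x: "x \<in> verts G" for x
  proof (cases "x \<in> {u, v}")
    case True
    then have "{x, if x = u then v else u} = {u, v}" by auto
    then obtain y where "{x, y} = {u, v}" "y \<in> verts G" using u v that by (metis (full_types))
    moreover have "gdist H x w \<le> t" if "w \<in> verts G" for w
      unfolding dist[OF x that] using t by (simp split: if_split) linarith
    ultimately have "eccentricity H x = t"
      using fin by (intro eccentricity_eqI[of _ y]) (simp_all add: V edge)
    then show ?thesis using True by simp
  next
    case False
    obtain w where "w \<in> verts G" "fst w = fst x" "w \<noteq> x"
      using vertex[OF fstV[OF x], of x] by (elim exE conjE)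
    then show ?thesis using x False fin
      by (intro eccentricity_eqI[of _ w]) (auto simp: V dist)
  qed
  have "ecc_entry H x y = (if fst x = fst y \<and> x \<noteq> y then 2 else if {x, y} = {u, v} then t else 0)"
    if "x \<in> verts G" "y \<in> verts G" for x y
  proof (cases "{x, y} = {u, v}")
    case True
    then have "x \<in> {u, v}" "y \<in> {u, v}" "x \<noteq> y" "fst x \<noteq> fst y" using uv by (auto simp: doubleton_eq_iff)
    with True show ?thesis
      unfolding ecc_entry_def dist[OF that] ecc[OF that(1)] ecc[OF that(2)] by simp
  next
    case False
    \<comment> \<open>At most one of two such distinct vertices has eccentricity \<open>t\<close>,
      so the minimum of the eccentricities is 2.\<close>
    then have "\<not> (x \<in> {u, v} \<and> y \<in> {u, v})" if "x \<noteq> y" using that by auto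
    moreover have "min t 2 = 2" "min 2 t = 2" using t by auto
    ultimately show ?thesis using False t
      unfolding ecc_entry_def dist[OF that] ecc[OF that(1)] ecc[OF that(2)] by (simp split: if_split) auto
  qed
  then show ?thesis using t unfolding H_def by blast
qed

section \<open>The energy of the complete multipartite graph\<close>

lemma card_part:
  assumes "i \<in> {1..k}"
  shows "card {w \<in> verts (complete_multipartite k m). fst w = i} = m i"
proof -
  have "{w \<in> verts (complete_multipartite k m). fst w = i} = {i} \<times> {1..m i}"
    using assms by (auto simp: verts_complete_multipartite)
  then show ?thesis by (simp add: card_cartesian_product)
qed

lemma card_verts_complete_multipartite:
  "card (verts (complete_multipartite k m)) = (\<Sum>i=1..k. m i)"
  by (simp add: verts_complete_multipartite)

lemma sum_nth_distinct:
  assumes "distinct xs"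
  shows "(\<Sum>i<length xs. f (xs ! i)) = (\<Sum>x\<in>set xs. f x)"
  by (rule sum.reindex_bij_betw) (rule bij_betw_nth[OF assms refl refl])

text \<open>Energy as a function of the characteristic polynomial. It is additive over products, so
  it can be applied to both sides of a factorisation without cancelling common factors.\<close>

definition poly_energy :: "complex poly \<Rightarrow> real" where
  "poly_energy p = (\<Sum>\<xi>\<in>#proots p. cmod \<xi>)"

lemma poly_energy_mult: "p \<noteq> 0 \<Longrightarrow> q \<noteq> 0 \<Longrightarrow> poly_energy (p * q) = poly_energy p + poly_energy q"
  by (simp add: poly_energy_def proots_mult)

lemma poly_energy_power: "p \<noteq> 0 \<Longrightarrow> poly_energy (p ^ n) = n * poly_energy p"
  by (induction n) (simp_all add: poly_energy_mult algebra_simps, simp add: poly_energy_def)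

lemma poly_energy_prod:
  assumes "\<And>x. x \<in> X \<Longrightarrow> f x \<noteq> 0"
  shows "poly_energy (\<Prod>x\<in>X. f x) = (\<Sum>x\<in>X. poly_energy (f x))"
  using assms by (induction X rule: infinite_finite_induct)
    (auto simp: poly_energy_mult, simp_all add: poly_energy_def)

lemma poly_energy_linear: "poly_energy [:a, 1:] = cmod a"
  by (simp add: poly_energy_def)

text \<open>\<open>C + 2 I\<close> is twice the same-part indicator matrix and factors through the
  \<open>k\<close> parts, where \<open>B * A\<close> is diagonal with entries twice the part sizes.
  The spectrum is thus -2 with multiplicity \<open>n - k\<close> together with
  \<open>2 * m i - 2\<close> for each part, and both groups contribute
  \<open>2 * (n - k)\<close>.\<close>

lemma ecc_energy_complete_multipartite:
  assumes m: "\<And>i. i \<in> {1..k} \<Longrightarrow> m i \<ge> 2" and k: "2 \<le> k"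
  shows "ecc_energy (complete_multipartite k m) = 4 * (real (\<Sum>i=1..k. m i) - k)"
proof -
  define G where "G = complete_multipartite k m"
  obtain xs where xs: "distinct xs" "set xs = verts G"
    using finite_distinct_list[of "verts G"] finite_verts_complete_multipartite[of k m] G_def by auto
  define n where "n = length xs"
  have n: "n = (\<Sum>i=1..k. m i)"
    using distinct_card[OF xs(1)] card_verts_complete_multipartite[of k m] xs by (simp add: n_def G_def)
  have nth: "xs ! i \<in> verts G" if "i < n" for i using that xs by (simp add: n_def flip: xs(2))
  define C where "C = ecc_matrix G xs"
  \<comment> \<open>Matrix indices start at 0 and parts at 1, so index \<open>l\<close> stands for
    part \<open>Suc l\<close>.\<close>
  define A :: "complex mat" where "A = mat n k (\<lambda>(i, l). if fst (xs ! i) = Suc l then 2 else 0)"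
  define B :: "complex mat" where "B = mat k n (\<lambda>(l, j). if fst (xs ! j) = Suc l then 1 else 0)"
  have A: "A \<in> carrier_mat n k" and B: "B \<in> carrier_mat k n" and C: "C \<in> carrier_mat n n"
    by (auto simp: A_def B_def C_def ecc_matrix_def n_def)
  have "C + 2 \<cdot>\<^sub>m 1\<^sub>m n = A * B"
  proof (rule eq_matI)
    fix i j assume ij: "i < dim_row (A * B)" "j < dim_col (A * B)"
    then have ij: "i < n" "j < n" using A B by auto
    define l where "l = fst (xs ! i) - 1"
    have l: "l < k" "fst (xs ! i) = Suc l" using fst_vertex[of "xs ! i" k m] nth[OF ij(1)]
      by (auto simp: G_def l_def)
    have "(A * B) $$ (i, j) =
      (\<Sum>l<k. (if fst (xs ! i) = Suc l then 2 else 0) * (if fst (xs ! j) = Suc l then 1 else 0))"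
      using ij by (simp add: A_def B_def scalar_prod_def atLeast0LessThan)
    also have "\<dots> = (\<Sum>l'<k. if l' = l then (if fst (xs ! j) = Suc l then 2 else 0) else 0)"
      using l by (intro sum.cong) auto
    also have "\<dots> = (if fst (xs ! j) = Suc l then 2 else 0)" using l by simp
    also have "\<dots> = (C + 2 \<cdot>\<^sub>m 1\<^sub>m n) $$ (i, j)"
      using ij l nth_eq_iff_index_eq[OF xs(1), of i j] ecc_entry_complete_multipartite[of k m, OF m k, folded G_def] nth
      by (auto simp: C_def ecc_matrix_def n_def[symmetric])
    finally show "(C + 2 \<cdot>\<^sub>m 1\<^sub>m n) $$ (i, j) = (A * B) $$ (i, j)" ..
  qed (use A B C in auto)
  from char_poly_low_rank[OF A B C this]
  have eq: "[:2, 1:] ^ k * char_poly C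
    = [:2, 1:] ^ n * det ([:2, 1:] \<cdot>\<^sub>m 1\<^sub>m k - map_mat (\<lambda>a. [:a:]) (B * A))" (is "_ = _ * det ?D") .
  have BA: "(B * A) $$ (l, l') = (if l = l' then 2 * of_nat (m (Suc l)) else 0)" if l: "l < k" "l' < k" for l l'
  proof -
    have "(B * A) $$ (l, l') = (\<Sum>i<n. (if fst (xs ! i) = Suc l then 1 else 0) * (if fst (xs ! i) = Suc l' then 2 else 0))"
      using l by (simp add: A_def B_def scalar_prod_def atLeast0LessThan)
    also have "\<dots> = (\<Sum>x\<in>verts G. (if fst x = Suc l then 1 else 0) * (if fst x = Suc l' then 2 else 0))"
      unfolding n_def xs(2)[symmetric] by (rule sum_nth_distinct[OF xs(1)])
    also have "\<dots> = (\<Sum>x\<in>verts G. if fst x = Suc l then (if l = l' then 2 else 0) else 0)"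
      by (intro sum.cong) auto
    also have "\<dots> = (if l = l' then 2 * of_nat (m (Suc l)) else 0)"
      using l finite_verts_complete_multipartite[of k m] card_part[of "Suc l" k m]
      by (simp add: G_def flip: sum.inter_filter)
    finally show ?thesis .
  qed
  have DC: "?D \<in> carrier_mat k k" using mult_carrier_mat[OF B A] by (simp add: minus_carrier_mat)
  have D: "?D $$ (l, l') = (if l = l' then [:2 - 2 * of_nat (m (Suc l)), 1:] else 0)" if "l < k" "l' < k" for l l'
    using that A B BA[OF that] by simp
  have "det ?D = prod_list (diag_mat ?D)"
  proof (rule det_upper_triangular[OF _ DC])
    show "upper_triangular ?D"
      unfolding upper_triangular_def carrier_matD(1)[OF DC] using D by (metis less_trans less_irrefl)
  qed
  also have "\<dots> = (\<Prod>l<k. [:2 - 2 * of_nat (m (Suc l)), 1:])"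
  proof -
    have "diag_mat ?D = map (\<lambda>l. [:2 - 2 * of_nat (m (Suc l)), 1:]) [0..<k]"
      unfolding diag_mat_def carrier_matD(1)[OF DC] using D by (intro map_cong) auto
    then show ?thesis by (simp add: prod.list_conv_set_nth atLeast0LessThan)
  qed
  finally have eq: "[:2, 1:] ^ k * char_poly C = [:2, 1:] ^ n * (\<Prod>l<k. [:2 - 2 * of_nat (m (Suc l)), 1:])"
    using eq by simp
  have C0: "char_poly C \<noteq> 0" using degree_monic_char_poly[OF C] by auto
  from arg_cong[OF eq, of poly_energy]
  have "2 * k + poly_energy (char_poly C) = 2 * n + (\<Sum>l<k. cmod (2 - 2 * of_nat (m (Suc l))))"
    using C0 by (simp add: poly_energy_mult poly_energy_power poly_energy_prod poly_energy_linear prod_zero_iff)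
  also have "(\<Sum>l<k. cmod (2 - 2 * of_nat (m (Suc l)))) = (\<Sum>l<k. 2 * real (m (Suc l)) - 2)"
  proof (intro sum.cong refl)
    fix l assume "l \<in> {..<k}"
    then have "2 \<le> m (Suc l)" using m by auto
    have "cmod (2 - 2 * of_nat (m (Suc l))) = cmod (of_real (2 - 2 * real (m (Suc l))))" by simp
    also have "\<dots> = \<bar>2 - 2 * real (m (Suc l))\<bar>" by (rule norm_of_real)
    finally show "cmod (2 - 2 * of_nat (m (Suc l))) = 2 * real (m (Suc l)) - 2"
      using \<open>2 \<le> m (Suc l)\<close> by simp
  qed
  also have "\<dots> = 2 * real (\<Sum>i=1..k. m i) - 2 * k"
    by (simp add: sum_subtractf sum_distrib_left sum.atLeast1_atMost_eq)
  finally show ?thesis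
    using ecc_energy_eq[OF xs] n by (simp add: G_def C_def poly_energy_def)
qed

section \<open>Eigenvalues and energy after the edge deletion\<close>

text \<open>Lets an eigenvector be given as a real function \<open>g\<close> on the vertices,
  independently of their enumeration; \<open>x\<close> witnesses that it is not zero.\<close>

lemma ecc_matrix_eigenvalue:
  assumes xs: "distinct xs" "set xs = verts G"
    and ev: "\<And>x. x \<in> verts G \<Longrightarrow> (\<Sum>w\<in>verts G. real (ecc_entry G x w) * g w) = \<mu> * g x"
    and x: "x \<in> verts G" "g x \<noteq> 0"
  shows "poly (char_poly (ecc_matrix G xs)) (complex_of_real \<mu>) = 0"
proof -
  let ?n = "length xs"
  define h where "h = vec ?n (\<lambda>i. complex_of_real (g (xs ! i)))"
  have C: "ecc_matrix G xs \<in> carrier_mat ?n ?n" by (simp add: ecc_matrix_def)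
  obtain i where i: "i < ?n" "xs ! i = x" using x xs by (metis in_set_conv_nth)
  have "h \<noteq> 0\<^sub>v ?n"
  proof
    assume "h = 0\<^sub>v ?n"
    then have "h $ i = 0" using i by simp
    then show False using i x by (simp add: h_def)
  qed
  moreover have "ecc_matrix G xs *\<^sub>v h = complex_of_real \<mu> \<cdot>\<^sub>v h"
  proof (rule eq_vecI)
    fix i assume "i < dim_vec (complex_of_real \<mu> \<cdot>\<^sub>v h)"
    then have i: "i < ?n" by (simp add: h_def)
    have "(ecc_matrix G xs *\<^sub>v h) $ i =
        complex_of_real (\<Sum>j<?n. real (ecc_entry G (xs ! i) (xs ! j)) * g (xs ! j))"
      using i by (simp add: ecc_matrix_def h_def scalar_prod_def atLeast0LessThan)
    also have "(\<Sum>j<?n. real (ecc_entry G (xs ! i) (xs ! j)) * g (xs ! j)) = \<mu> * g (xs ! i)"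
      using sum_nth_distinct[OF xs(1), of "\<lambda>w. real (ecc_entry G (xs ! i) w) * g w"] ev[of "xs ! i"] i
      by (simp flip: xs(2))
    finally show "(ecc_matrix G xs *\<^sub>v h) $ i = (complex_of_real \<mu> \<cdot>\<^sub>v h) $ i"
      using i by (simp add: h_def)
  qed (simp add: ecc_matrix_def h_def)
  ultimately have "eigenvalue (ecc_matrix G xs) (complex_of_real \<mu>)"
    unfolding eigenvalue_def eigenvector_def by (intro exI[of _ h]) (simp add: ecc_matrix_def h_def)
  then show ?thesis using eigenvalue_root_char_poly[OF C] by simp
qed

text \<open>Compares the multiplicity of the root \<open>- c\<close> on the two sides of
  \<open>char_poly_low_rank\<close>. The additive form avoids truncated subtraction.\<close>

lemma order_char_poly_low_rank:
  fixes A :: "'a :: idom mat"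
  assumes A: "A \<in> carrier_mat n m" and B: "B \<in> carrier_mat m n" and C: "C \<in> carrier_mat n n"
    and eq: "C + c \<cdot>\<^sub>m 1\<^sub>m n = A * B"
  shows "n \<le> m + Polynomial.order (- c) (char_poly C)"
proof -
  obtain D where eq: "[:c, 1:] ^ m * char_poly C = [:c, 1:] ^ n * D"
    using char_poly_low_rank[OF assms] by blast
  have ord: "Polynomial.order (- c) ([:c, 1:] ^ j) = j" for j
    using order_power_n_n[of "- c" j] by simp
  have "char_poly C \<noteq> 0" using degree_monic_char_poly[OF C] by auto
  then have ne: "[:c, 1:] ^ m * char_poly C \<noteq> 0" by simp
  have "m + Polynomial.order (- c) (char_poly C) = Polynomial.order (- c) ([:c, 1:] ^ m * char_poly C)"
    using ne by (simp add: order_mult ord)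
  also have "\<dots> = n + Polynomial.order (- c) D" using ne unfolding eq by (simp add: order_mult ord)
  finally show ?thesis by simp
qed

lemma ecc_energy_delete_edge_gt:
  assumes m: "\<And>i. i \<in> {1..k} \<Longrightarrow> m i \<ge> 2"
  defines "G \<equiv> complete_multipartite k m"
  assumes u: "u \<in> verts G" and v: "v \<in> verts G" and uv: "fst u \<noteq> fst v"
  shows "4 * (real (\<Sum>i=1..k. m i) - k) < ecc_energy (delete_edge G {u, v})"
proof -
  define H where "H = delete_edge G {u, v}"
  have VH: "verts H = verts G" by (simp add: H_def)
  obtain \<tau> :: nat where \<tau>: "\<tau> = 2 \<or> \<tau> = 3"
    and entry: "\<And>x y. x \<in> verts G \<Longrightarrow> y \<in> verts G \<Longrightarrow> ecc_entry H x y =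
      (if fst x = fst y \<and> x \<noteq> y then 2 else if {x, y} = {u, v} then \<tau> else 0)"
    using ecc_entry_delete_edge[of k m u v, OF m u[unfolded G_def] v[unfolded G_def] uv]
    unfolding H_def G_def by auto
  have fin: "finite (verts G)" by (simp add: G_def finite_verts_complete_multipartite)
  obtain xs where xs: "distinct xs" "set xs = verts G" using finite_distinct_list[OF fin] by auto
  define n where "n = length xs"
  have n: "n = (\<Sum>i=1..k. m i)"
    using distinct_card[OF xs(1)] card_verts_complete_multipartite[of k m] xs by (simp add: n_def G_def)
  have nth: "xs ! i \<in> verts G" if "i < n" for i using that xs by (simp add: n_def flip: xs(2))
  have fstV: "fst x \<in> {1..k}" if "x \<in> verts G" for x using fst_vertex that by (simp add: G_def)
  define C where "C = ecc_matrix H xs"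
  have C: "C \<in> carrier_mat n n" by (simp add: C_def ecc_matrix_def n_def)
  have C0: "char_poly C \<noteq> 0" using degree_monic_char_poly[OF C] by auto
  have trace: "(\<Sum>\<xi>\<in>#proots (char_poly C). \<xi>) = 0"
  proof -
    have "C $$ (i, i) = 0" if "i < n" for i
      using that nth[OF that] uv entry by (auto simp: C_def ecc_matrix_def n_def[symmetric] doubleton_eq_iff)
    then show ?thesis using sum_proots_char_poly[OF C] by simp
  qed

  have "n \<le> (k + 2) + Polynomial.order (- 2) (char_poly C)"
  proof -
    \<comment> \<open>The first \<open>k\<close> indices encode the parts as for the full graph.
      Index \<open>k\<close> adds the entry \<open>\<tau>\<close> at row \<open>u\<close> and column
      \<open>v\<close>, and index \<open>k + 1\<close> adds it at row \<open>v\<close> and column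
      \<open>u\<close>.\<close>
    define A :: "complex mat" where "A = mat n (k + 2) (\<lambda>(i, l).
      if l < k then (if fst (xs ! i) = Suc l then 2 else 0)
      else if l = k then (if xs ! i = u then of_nat \<tau> else 0)
      else (if xs ! i = v then of_nat \<tau> else 0))"
    define B :: "complex mat" where "B = mat (k + 2) n (\<lambda>(l, j).
      if l < k then (if fst (xs ! j) = Suc l then 1 else 0)
      else if l = k then (if xs ! j = v then 1 else 0)
      else (if xs ! j = u then 1 else 0))"
    have A: "A \<in> carrier_mat n (k + 2)" and B: "B \<in> carrier_mat (k + 2) n"
      by (auto simp: A_def B_def)
    have "C + 2 \<cdot>\<^sub>m 1\<^sub>m n = A * B"
    proof (rule eq_matI)
      fix i j assume ij: "i < dim_row (A * B)" "j < dim_col (A * B)"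
      then have ij: "i < n" "j < n" using A B by auto
      define l where "l = fst (xs ! i) - 1"
      have l: "l < k" "fst (xs ! i) = Suc l" using fstV[OF nth[OF ij(1)]] by (auto simp: l_def)
      have "(A * B) $$ (i, j) =
        (\<Sum>l<k. (if fst (xs ! i) = Suc l then 2 else 0) * (if fst (xs ! j) = Suc l then 1 else 0))
        + (if xs ! i = u then of_nat \<tau> else 0) * (if xs ! j = v then 1 else 0)
        + (if xs ! i = v then of_nat \<tau> else 0) * (if xs ! j = u then 1 else 0)"
        using ij by (simp add: A_def B_def scalar_prod_def atLeast0LessThan numeral_2_eq_2)
      also have "(\<Sum>l<k. (if fst (xs ! i) = Suc l then 2 else 0) * (if fst (xs ! j) = Suc l then 1 else 0 :: complex))
        = (\<Sum>l'<k. if l' = l then (if fst (xs ! j) = Suc l then 2 else 0) else 0)"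
        using l by (intro sum.cong) auto
      also have "\<dots> = (if fst (xs ! j) = fst (xs ! i) then 2 else 0)" using l by simp
      also have "\<dots> + (if xs ! i = u then of_nat \<tau> else 0) * (if xs ! j = v then 1 else 0)
        + (if xs ! i = v then of_nat \<tau> else 0) * (if xs ! j = u then 1 else 0) = (C + 2 \<cdot>\<^sub>m 1\<^sub>m n) $$ (i, j)"
        using ij nth_eq_iff_index_eq[OF xs(1), of i j] entry[OF nth[OF ij(1)] nth[OF ij(2)]] uv
        by (auto simp: C_def ecc_matrix_def n_def[symmetric] doubleton_eq_iff)
      finally show "(C + 2 \<cdot>\<^sub>m 1\<^sub>m n) $$ (i, j) = (A * B) $$ (i, j)" ..
    qed (use A B C in auto)
    then show ?thesis by (rule order_char_poly_low_rank[OF A B C])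
  qed
  then have mult: "n - (k + 2) \<le> count (proots (char_poly C)) (- 2)" using C0 by simp

  define a b t where "a = m (fst u)" and "b = m (fst v)" and "t = real \<tau>"
  have ab: "2 \<le> a" "2 \<le> b" using m fstV u v by (auto simp: a_def b_def)
  have t: "0 < t" "t \<le> 3" using \<tau> by (auto simp: t_def)
  have root: "poly (char_poly C) (complex_of_real (y - 2)) = 0"
    if Q: "y\<^sup>2 * (y - 2 * a) * (y - 2 * b) - t\<^sup>2 * (y - 2 * a + 2) * (y - 2 * b + 2) = 0" and y: "y \<noteq> 0"
    for y :: real
  proof -
    \<comment> \<open>The eigenvector is constant on each part apart from corrections at u and v; solving for the
      four constants and clearing denominators avoids dividing by y - 2a or y - 2b, which may vanish.\<close>
    define \<alpha> \<beta> \<gamma> \<delta> where "\<alpha> = y\<^sup>2 * (y - 2 * b) - t\<^sup>2 * (y - 2 * b + 2)" and "\<beta> = 2 * t * y"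
      and "\<gamma> = t\<^sup>2 * (y - 2 * b + 2)" and "\<delta> = t * y * (y - 2 * b)"
    define g where "g w = (if fst w = fst u then \<alpha> else 0) + (if fst w = fst v then \<beta> else 0)
      + (if w = u then \<gamma> else 0) + (if w = v then \<delta> else 0)" for w
    have part: "(\<Sum>w\<in>verts G. if fst w = i then g w else 0) =
        (if i = fst u then a * \<alpha> + \<gamma> else 0) + (if i = fst v then b * \<beta> + \<delta> else 0)"
      if i: "i \<in> {1..k}" for i
    proof -
      let ?V = "{w \<in> verts G. fst w = i}"
      have finV: "finite ?V" using fin by simp
      have card: "card ?V = m i" using card_part[OF i] by (simp add: G_def)
      have "(\<Sum>w\<in>verts G. if fst w = i then g w else 0) = (\<Sum>w\<in>?V. g w)"
        using fin by (simp add: sum.inter_filter)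
      also have "\<dots> = (\<Sum>w\<in>?V. (if i = fst u then \<alpha> else 0) + (if i = fst v then \<beta> else 0)
          + (if w = u then \<gamma> else 0) + (if w = v then \<delta> else 0))"
        by (intro sum.cong) (auto simp: g_def)
      also have "\<dots> = (if i = fst u then a * \<alpha> else 0) + (if i = fst v then b * \<beta> else 0)
          + (if u \<in> ?V then \<gamma> else 0) + (if v \<in> ?V then \<delta> else 0)"
        using finV uv by (auto simp: sum.distrib card a_def b_def)
      finally show ?thesis using u v uv by auto
    qed
    have "(\<Sum>w\<in>verts H. real (ecc_entry H x w) * g w) = (y - 2) * g x" if "x \<in> verts H" for x
    proof -
      have x: "x \<in> verts G" using that VH by simp
      have "(\<Sum>w\<in>verts H. real (ecc_entry H x w) * g w) =
          (\<Sum>w\<in>verts G. 2 * (if fst w = fst x then g w else 0) - (if w = x then 2 * g x else 0)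
            + (if w = v then (if x = u then t * g v else 0) else 0)
            + (if w = u then (if x = v then t * g u else 0) else 0))"
        unfolding VH using x uv
        by (intro sum.cong refl) (auto simp: entry t_def doubleton_eq_iff)
      also have "\<dots> = 2 * (\<Sum>w\<in>verts G. if fst w = fst x then g w else 0) - 2 * g x
            + (if x = u then t * g v else 0) + (if x = v then t * g u else 0)"
        using fin x u v by (simp add: sum.distrib sum_subtractf flip: sum_distrib_left)
      also have "\<dots> = (y - 2) * g x"
      proof -
        \<comment> \<open>After adding 2 on the diagonal, the eigenvalue equation splits into
          \<open>1\<close> and \<open>2\<close> for the constants on the two parts and
          \<open>3\<close> and \<open>4\<close> for the corrections at \<open>u\<close> and
          \<open>v\<close>. The choice of constants makes \<open>2\<close>, \<open>3\<close> and
          \<open>4\<close> identities, and \<open>1\<close> is the quartic equation itself.\<close>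
        have 1: "2 * (a * \<alpha> + \<gamma>) = y * \<alpha>"
          using Q unfolding \<alpha>_def \<gamma>_def by (simp add: power2_eq_square algebra_simps)
        have 2: "2 * (b * \<beta> + \<delta>) = y * \<beta>"
          unfolding \<beta>_def \<delta>_def by (simp add: algebra_simps)
        have 3: "t * (\<beta> + \<delta>) = y * \<gamma>"
          unfolding \<beta>_def \<gamma>_def \<delta>_def by (simp add: power2_eq_square algebra_simps)
        have 4: "t * (\<alpha> + \<gamma>) = y * \<delta>"
          unfolding \<alpha>_def \<gamma>_def \<delta>_def by (simp add: power2_eq_square algebra_simps)
        have g: "g u = \<alpha> + \<gamma>" "g v = \<beta> + \<delta>" using uv by (auto simp: g_def)
        have P: "2 * (\<Sum>w\<in>verts G. if fst w = fst x then g w else 0)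
          = y * (if fst x = fst u then \<alpha> else 0) + y * (if fst x = fst v then \<beta> else 0)"
          using part[OF fstV[OF x]] 1 2 uv by (simp add: distrib_left)
        have "2 * (\<Sum>w\<in>verts G. if fst w = fst x then g w else 0)
            + (if x = u then t * g v else 0) + (if x = v then t * g u else 0) = y * g x"
          unfolding P g 3 4 by (simp add: g_def distrib_left)
        then show ?thesis by (simp add: left_diff_distrib)
      qed
      finally show ?thesis .
    qed
    moreover have "\<exists>w. w \<in> verts G \<and> fst w = fst v \<and> w \<noteq> v"
      \<comment> \<open>At a vertex of the part of \<open>v\<close> other than \<open>v\<close>, the
        function \<open>g\<close> has the value \<open>\<beta> = 2 * t * y\<close>, which is nonzero
        whatever the other constants are.\<close>
      using ex_vertex_in_part[of "fst v" k m v] fstV[OF v] m by (simp add: G_def)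
    then obtain w where "w \<in> verts G" "fst w = fst v" "w \<noteq> v" by blast
    then have "w \<in> verts H" "g w \<noteq> 0" using uv y t by (auto simp: VH g_def \<beta>_def)
    ultimately show ?thesis unfolding C_def using xs VH
      by (intro ecc_matrix_eigenvalue[where g = g and x = w]) auto
  qed
  obtain y z where yz: "y < 0" "0 < z" "y + z < 0"
    and roots: "poly (char_poly C) (complex_of_real (y - 2)) = 0" "poly (char_poly C) (complex_of_real (z - 2)) = 0"
    using quartic_roots[OF ab t] root by (metis less_irrefl)

  define S where "S = replicate_mset (n - (k + 2)) (- 2) + {#complex_of_real (y - 2), complex_of_real (z - 2)#}"
  \<comment> \<open>Since \<open>y < 0 < z\<close>, the values -2, \<open>y - 2\<close> and
    \<open>z - 2\<close> are distinct, so the inclusion of \<open>S\<close> in the spectrum can be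
    checked one value at a time.\<close>
  have ne: "complex_of_real (y - 2) \<noteq> - 2" "complex_of_real (z - 2) \<noteq> - 2"
      "complex_of_real (y - 2) \<noteq> complex_of_real (z - 2)"
    using yz by (auto simp: complex_eq_iff)
  have "S \<subseteq># proots (char_poly C)"
  proof (rule mset_subset_eqI)
    fix x
    have "1 \<le> count (proots (char_poly C)) r" if "poly (char_poly C) r = 0" for r
      using that C0 by (metis One_nat_def Suc_leI count_greater_zero_iff mem_Collect_eq set_count_proots)
    then show "count S x \<le> count (proots (char_poly C)) x"
      using roots mult ne unfolding S_def by (auto simp del: of_real_diff)
  qed
  then have "2 * cmod (\<Sum>\<xi>\<in>#S. \<xi>) \<le> ecc_energy H"
    using sum_cmod_ge_twice_subset[OF _ trace] ecc_energy_eq[OF xs(1), of H] xs VH by (simp add: C_def)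
  \<comment> \<open>This makes the truncated difference in \<open>S\<close> a true one, so the
    \<open>n - k - 2\<close> copies of -2 and the shifts in \<open>y - 2\<close> and
    \<open>z - 2\<close> add up to \<open>- 2 * (n - k)\<close>.\<close>
  moreover have "k + 2 \<le> n"
  proof -
    have k: "2 \<le> k" using fstV[OF u] fstV[OF v] uv by auto
    have "2 * k = (\<Sum>i=1..k. 2)" by simp
    also have "\<dots> \<le> n" unfolding n using m by (intro sum_mono) auto
    finally show ?thesis using k by simp
  qed
  then have "(\<Sum>\<xi>\<in>#S. \<xi>) = complex_of_real (y + z - 2 * (real n - k))"
    by (simp add: S_def of_nat_diff algebra_simps)
  then have "cmod (\<Sum>\<xi>\<in>#S. \<xi>) = \<bar>y + z - 2 * (real n - k)\<bar>" by (simp only: norm_of_real)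
  ultimately show ?thesis using yz unfolding H_def n by linarith
qed

theorem theorem2p9:
  fixes k n :: nat and m :: "nat \<Rightarrow> nat" and e :: "(nat \<times> nat) set"
  assumes "(\<Sum>i=1..k. m i) = n"
    and "\<And>i. i \<in> {1..k} \<Longrightarrow> m i \<ge> 2"
    and "e \<in> edges (complete_multipartite k m)"
  shows "ecc_energy (complete_multipartite k m)
           < ecc_energy (delete_edge (complete_multipartite k m) e)"
proof -
  obtain u v where e: "e = {u, v}" and uv: "u \<in> verts (complete_multipartite k m)"
      "v \<in> verts (complete_multipartite k m)" "fst u \<noteq> fst v"
    using assms(3) unfolding complete_multipartite_def Let_def sgraph.select_convs by blast
  have "2 \<le> k" using fst_vertex[OF uv(1)] fst_vertex[OF uv(2)] uv(3) by auto
  then show ?thesis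
    using ecc_energy_complete_multipartite[of k m, OF assms(2)]
      ecc_energy_delete_edge_gt[of k m u v, OF assms(2) uv] e by simp
qed

end
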